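(* Let $\mathcal{R}^{\mathrm{S}}:\mathcal{B}\to\mathbb{R}_+$ be a convex function, $\bm{y}\in\mathbb{R}^L$, $\lambda_1,\lambda_2>0$, $\bm{\Phi}_1=(\phi_{1,1},\dots,\phi_{1,L})\in\mathcal{A}^L$ and $\bm{\Phi}_2=(\phi_{2,1},\dots,\phi_{2,L})\in\mathcal{H}^L$. Define $$\mathcal{W}(\lambda_1,\lambda_2):=\underset{(s_1,s_2)\in\mathcal{B}\times\mathcal{H}}{\arg\min}\ \frac12\|\bm{y}-(\bm{\Phi}_1(s_1)+\bm{\Phi}_2(s_2))\|_2^2+\lambda_1\mathcal{R}^{\mathrm{S}}(s_1)+\frac{\lambda_2}{2}\|s_2\|_{\mathcal{H}}^2,$$ $$\mathcal{V}(\mathbf{M}_{\lambda_2},\lambda_1):=\underset{s_1\in\mathcal{B}}{\arg\min}\ \frac12\big\|\mathbf{M}_{\lambda_2}^{-1/2}(\bm{y}-\bm{\Phi}_1(s_1))\big\|_2^2+\lambda_1\mathcal{R}^{\mathrm{S}}(s_1).$$ Then the vector $\bm{w}:=\bm{\Phi}_1(\widehat{s}_1)\in\mathbb{R}^L$ is the same for all $\widehat{s}_1\in\mathcal{V}(\mathbf{M}_{\lambda_2},\lambda_1)$, and $$\mathcal{W}(\lambda_1,\lambda_2)=\mathcal{V}(\mathbf{M}_{\lambda_2},\lambda_1)\times\{\widehat{s}_2\},\qquad \widehat{s}_2:=\frac{1}{\lambda_2}\bm{\Phi}_2^*\mathbf{M}_{\lambda_2}^{-1}(\bm{y}-\bm{w}).$$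 (If $\mathcal{V}(\mathbf{M}_{\lambda_2},\lambda_1)$ is empty, so that $\bm{w}$ is not defined, the identity is understood as $\mathcal{W}(\lambda_1,\lambda_2)=\emptyset$.)
   Context: All spaces are real, and $L\ge 1$ is an integer. $(\mathcal{A},\|\cdot\|_{\mathcal{A}})$ is a Banach space and $\mathcal{B}=\mathcal{A}'$ is its topological dual with the dual norm $\|s\|_{\mathcal{B}}=\sup_{\|u\|_{\mathcal{A}}=1}\langle u,s\rangle_{\mathcal{A}\times\mathcal{B}}$, where $\langle u,s\rangle_{\mathcal{A}\times\mathcal{B}}=s(u)$. $\mathcal{H}$ is a Hilbert space with inner product $\langle\cdot,\cdot\rangle_{\mathcal{H}}$ and norm $\|\cdot\|_{\mathcal{H}}$. For $\bm{\Phi}_1\in\mathcal{A}^L$, the same symbol denotes the linear map $\bm{\Phi}_1:\mathcal{B}\to\mathbb{R}^L$, $\bm{\Phi}_1(s)=(\langle\phi_{1,\ell},s\rangle_{\mathcal{A}\times\mathcal{B}})_{1\le\ell\le L}$. For $\bm{\Phi}_2\in\mathcal{H}^L$, the same symbol denotes the linear map $\bm{\Phi}_2:\mathcal{H}\to\mathbb{R}^L$, $\bm{\Phi}_2(s)=(\langle\phi_{2,\ell},s\rangle_{\mathcal{H}})_{1\le\ell\le L}$, with adjoint $\bm{\Phi}_2^*:\mathbb{R}^L\to\mathcal{H}$, $\bm{\Phi}_2^*(\bm{h})=\sum_{\ell=1}^L h_\ell\,\phi_{2,\ell}$. The $L\times L$ matrix $$\mathbf{M}_{\lambda_2}:=\frac{1}{\lambda_2}\left(\bm{\Phi}_2\bm{\Phi}_2^*+\lambda_2\mathbf{I}_L\right)=\frac{1}{\lambda_2}\big(\langle\phi_{2,k},\phi_{2,\ell}\rangle_{\mathcal{H}}+\lambda_2\,\delta[k-\ell]\big)_{1\le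 k,\ell\le L}$$ is symmetric positive definite; $\mathbf{M}_{\lambda_2}^{-1/2}$ is the inverse of its positive definite square root. *)

theory Defs
  imports "HOL-Analysis.Analysis"
begin

text \<open>The topological dual of a Banach space \<open>'a\<close> is the type \<open>'a \<Rightarrow>\<^sub>L real\<close> of bounded linear
  functionals with the operator norm. \<open>\<real>\<^sup>L\<close> is \<open>real ^ 'n\<close> with \<open>L = CARD('n) \<ge> 1\<close>, whose norm is
  the Euclidean one.\<close>

definition dual_meas :: "'a::banach ^ 'n \<Rightarrow> ('a \<Rightarrow>\<^sub>L real) \<Rightarrow> real ^ 'n::finite"
  where "dual_meas \<Phi> s = (\<chi> l. blinfun_apply s (\<Phi> $ l))"

definition hilbert_meas :: "'h::{real_inner,complete_space} ^ 'n \<Rightarrow> 'h \<Rightarrow> real ^ 'n::finite"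
  where "hilbert_meas \<Phi> s = (\<chi> l. (\<Phi> $ l) \<bullet> s)"

definition hilbert_meas_adj :: "'h::{real_inner,complete_space} ^ 'n \<Rightarrow> real ^ 'n::finite \<Rightarrow> 'h"
  where "hilbert_meas_adj \<Phi> h = (\<Sum>l\<in>UNIV. h $ l *\<^sub>R \<Phi> $ l)"

lemma hilbert_meas_adjoint: "hilbert_meas \<Phi> s \<bullet> h = s \<bullet> hilbert_meas_adj \<Phi> h"
  by (simp add: hilbert_meas_def hilbert_meas_adj_def inner_vec_def inner_sum_right
      inner_commute mult.commute)

definition M_mat :: "'h::{real_inner,complete_space} ^ 'n \<Rightarrow> real \<Rightarrow> real ^ 'n ^ 'n::finite"
  where "M_mat \<Phi> lam =
    (1 / lam) *\<^sub>R (matrix (\<lambda>h. hilbert_meas \<Phi> (hilbert_meas_adj \<Phi> h)) + lam *\<^sub>R mat 1)"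

lemma M_mat_nth:
  "M_mat \<Phi> lam $ k $ l = (1 / lam) * ((\<Phi> $ k) \<bullet> (\<Phi> $ l) + lam * (if k = l then 1 else 0))"
proof -
  have "hilbert_meas_adj \<Phi> (axis l 1) = \<Phi> $ l"
    by (simp add: hilbert_meas_adj_def axis_def if_distrib[of "\<lambda>c. c *\<^sub>R _"] sum.delta cong: if_cong)
  then show ?thesis
    by (simp add: M_mat_def matrix_def hilbert_meas_def mat_def)
qed

definition sym_posdef :: "real ^ 'n ^ 'n::finite \<Rightarrow> bool"
  where "sym_posdef A \<longleftrightarrow> transpose A = A \<and> (\<forall>x. x \<noteq> 0 \<longrightarrow> 0 < x \<bullet> (A *v x))"

lemma sym_posdef_M_mat:
  assumes "lam > 0"
  shows "sym_posdef (M_mat \<Phi> lam)"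
proof -
  let ?f = "\<lambda>h. hilbert_meas \<Phi> (hilbert_meas_adj \<Phi> h)"
  have lin: "linear ?f"
    by (rule linearI)
      (simp_all add: hilbert_meas_def hilbert_meas_adj_def vec_eq_iff inner_add_right
        scaleR_left_distrib sum.distrib inner_sum_right sum_distrib_left mult.assoc)
  have mv: "M_mat \<Phi> lam *v x = (1 / lam) *\<^sub>R (?f x + lam *\<^sub>R x)" for x
    using matrix_works[OF lin[folded linear_matrix_vector_mul_eq]]
    by (simp add: M_mat_def scaleR_matrix_vector_assoc[symmetric] matrix_vector_mult_add_rdistrib)
  have "0 < x \<bullet> (M_mat \<Phi> lam *v x)" if "x \<noteq> 0" for x
  proof -
    have "x \<bullet> ?f x = (norm (hilbert_meas_adj \<Phi> x))\<^sup>2"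
      by (metis hilbert_meas_adjoint inner_commute power2_norm_eq_inner)
    then have "x \<bullet> (M_mat \<Phi> lam *v x) = (1 / lam) * ((norm (hilbert_meas_adj \<Phi> x))\<^sup>2 + lam * (x \<bullet> x))"
      by (simp add: mv inner_add_right)
    then show ?thesis using that assms by (simp add: add_nonneg_pos)
  qed
  moreover have "transpose (M_mat \<Phi> lam) = M_mat \<Phi> lam"
    by (simp add: vec_eq_iff transpose_def M_mat_nth inner_commute)
  ultimately show ?thesis by (simp add: sym_posdef_def)
qed

text \<open>The positive definite square root; meaningful for \<open>sym_posdef A\<close>, where it is unique.\<close>

definition pd_sqrt :: "real ^ 'n ^ 'n::finite \<Rightarrow> real ^ 'n ^ 'n"
  where "pd_sqrt A = (THE S. sym_posdef S \<and> S ** S = A)"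

definition argmin_set :: "('b \<Rightarrow> real) \<Rightarrow> 'b set"
  where "argmin_set f = {x. is_arg_min f (\<lambda>_. True) x}"

definition W_set ::
  "real ^ 'n::finite \<Rightarrow> 'a::banach ^ 'n \<Rightarrow> 'h::{real_inner,complete_space} ^ 'n \<Rightarrow>
    (('a \<Rightarrow>\<^sub>L real) \<Rightarrow> real) \<Rightarrow> real \<Rightarrow> real \<Rightarrow> (('a \<Rightarrow>\<^sub>L real) \<times> 'h) set"
  where "W_set y \<Phi>1 \<Phi>2 R lam1 lam2 = argmin_set (\<lambda>(s1, s2).
    1 / 2 * (norm (y - (dual_meas \<Phi>1 s1 + hilbert_meas \<Phi>2 s2)))\<^sup>2
    + lam1 * R s1 + lam2 / 2 * (norm s2)\<^sup>2)"

definition V_set ::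
  "real ^ 'n::finite \<Rightarrow> 'a::banach ^ 'n \<Rightarrow> (('a \<Rightarrow>\<^sub>L real) \<Rightarrow> real) \<Rightarrow>
    real ^ 'n ^ 'n \<Rightarrow> real \<Rightarrow> ('a \<Rightarrow>\<^sub>L real) set"
  where "V_set y \<Phi>1 R M lam1 = argmin_set (\<lambda>s1.
    1 / 2 * (norm (matrix_inv (pd_sqrt M) *v (y - dual_meas \<Phi>1 s1)))\<^sup>2 + lam1 * R s1)"

end

theory Submission
  imports Defs
begin

text \<open>Completing the square in \<open>s2\<close> turns the joint objective into the reduced objective of \<open>s1\<close>
  plus a quadratic form in \<open>s2 - (1/\<lambda>2) \<Phi>2\<^sup>* M\<inverse> (y - \<Phi>1 s1)\<close> which vanishes only at
  \<open>0\<close>. Hence the joint minimisers are the pairs of a reduced minimiser and its associated \<open>s2\<close>,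
  and by strict convexity of the data term all reduced minimisers share the same measurement.\<close>

section \<open>The positive definite square root\<close>

lemma sym_inner:
  fixes A :: "real ^ 'n ^ 'n::finite"
  assumes "transpose A = A"
  shows "(A *v x) \<bullet> y = x \<bullet> (A *v y)"
  by (metis assms dot_lmul_matrix vector_transpose_matrix)

lemma sym_posdef_invertible:
  fixes A :: "real ^ 'n ^ 'n::finite"
  assumes "sym_posdef A"
  shows "invertible A"
proof -
  have "\<forall>x. A *v x = 0 \<longrightarrow> x = 0"
    using assms unfolding sym_posdef_def by (metis inner_zero_right less_irrefl)
  then show ?thesis
    using matrix_left_invertible_ker[of A] by (simp add: invertible_left_inverse)
qed

lemma invertible_matrix_inv:
  fixes A :: "'a::semiring_1 ^ 'n ^ 'm::finite"
  assumes "invertible A"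
  shows "A ** matrix_inv A = mat 1" "matrix_inv A ** A = mat 1"
  using someI_ex[OF assms[unfolded invertible_def]] by (auto simp: matrix_inv_def)

lemma invertible_mult_inv:
  fixes A :: "real ^ 'n ^ 'n::finite"
  assumes "invertible A"
  shows "A *v (matrix_inv A *v x) = x"
  by (simp add: assms invertible_matrix_inv matrix_vector_mul_assoc)

text \<open>The quadratic form attains its minimum on the compact unit sphere. That minimum is
  positive because its minimiser is nonzero, and homogeneity of degree two carries the bound to
  every \<open>x\<close>.\<close>

lemma sym_posdef_lower_bound:
  fixes A :: "real ^ 'n ^ 'n::finite"
  assumes "sym_posdef A"
  obtains m where "m > 0" "\<And>x. m * (norm x)\<^sup>2 \<le> x \<bullet> (A *v x)"
proof -
  let ?S = "sphere (0 :: real ^ 'n) 1"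
  have "continuous_on ?S (\<lambda>x. x \<bullet> (A *v x))"
    by (intro continuous_intros)
  moreover have "?S \<noteq> {}"
    by simp
  ultimately obtain u where u: "u \<in> ?S" "\<And>x. x \<in> ?S \<Longrightarrow> u \<bullet> (A *v u) \<le> x \<bullet> (A *v x)"
    using continuous_attains_inf[of ?S "\<lambda>x. x \<bullet> (A *v x)"] by auto
  show ?thesis
  proof
    show "u \<bullet> (A *v u) > 0"
      using u(1) assms unfolding sym_posdef_def by (metis mem_sphere_0 norm_zero zero_neq_one)
    show "u \<bullet> (A *v u) * (norm x)\<^sup>2 \<le> x \<bullet> (A *v x)" for x
    proof (cases "x = 0")
      case False
      then have "sgn x \<in> ?S"
        by (simp add: norm_sgn)
      from u(2)[OF this] have "u \<bullet> (A *v u) * (norm x)\<^sup>2 \<le> (sgn x \<bullet> (A *v sgn x)) * (norm x)\<^sup>2"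
        by (simp add: mult_right_mono)
      also have "\<dots> = x \<bullet> (A *v x)"
        using False by (simp add: sgn_div_norm matrix_vector_mult_scaleR power2_eq_square field_simps)
      finally show ?thesis .
    qed simp
  qed
qed

text \<open>Rescaling \<open>A\<close> brings \<open>I - t A\<close> into the open unit ball of
  operators, where the fixed-point construction of the root applies.\<close>

lemma ex_contracting_scale:
  fixes A :: "real ^ 'n ^ 'n::finite"
  assumes "sym_posdef A"
  obtains t r where "t > 0" "0 \<le> r" "r < 1" "\<And>x. norm (x - t *\<^sub>R (A *v x)) \<le> r * norm x"
proof -
  obtain m where m: "m > 0" "\<And>x. m * (norm x)\<^sup>2 \<le> x \<bullet> (A *v x)"
    using sym_posdef_lower_bound[OF assms] by blast
  obtain K where K: "K > 0" "\<And>x. norm (A *v x) \<le> norm x * K"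
    using bounded_linear.pos_bounded[OF matrix_vector_mul_bounded_linear[of A]] by blast
  \<comment> \<open>Expanding the square bounds the contraction factor squared by
    \<open>1 - 2 t m + t^2 K^2\<close>. This \<open>t\<close> minimises that quadratic, and
    \<open>q\<close> is its minimum.\<close>
  define t where "t = m / K\<^sup>2"
  define q where "q = 1 - m\<^sup>2 / K\<^sup>2"
  have t: "t > 0"
    using m K by (simp add: t_def)
  have bound: "(norm (x - t *\<^sub>R (A *v x)))\<^sup>2 \<le> q * (norm x)\<^sup>2" for x
  proof -
    have "(norm (x - t *\<^sub>R (A *v x)))\<^sup>2
        = (norm x)\<^sup>2 - 2 * t * (x \<bullet> (A *v x)) + t\<^sup>2 * (norm (A *v x))\<^sup>2"
      unfolding power2_norm_eq_inner
      by (simp add: inner_diff_left inner_diff_right inner_commute power2_eq_square algebra_simps)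
    also have "\<dots> \<le> (norm x)\<^sup>2 - 2 * t * (m * (norm x)\<^sup>2) + t\<^sup>2 * (norm x * K)\<^sup>2"
      using m(2)[of x] K(2)[of x] t by (intro add_mono diff_mono mult_left_mono power_mono) auto
    also have "\<dots> = q * (norm x)\<^sup>2"
      using K(1) by (simp add: t_def q_def field_simps power2_eq_square)
    finally show ?thesis .
  qed
  \<comment> \<open>At a unit vector the bound says that a square is at most \<open>q\<close>, so
    the root of \<open>q\<close> can serve as the factor \<open>r\<close>.\<close>
  have "0 \<le> q"
  proof -
    obtain u :: "real ^ 'n" where "norm u = 1"
      using vector_choose_size[of 1] by auto
    then show ?thesis
      using bound[of u] by (metis mult.right_neutral one_power2 order_trans zero_le_power2)
  qed
  show ?thesis
  proof
    show "t > 0" by fact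
    show "0 \<le> sqrt q" using \<open>0 \<le> q\<close> by simp
    show "sqrt q < 1" using m K by (simp add: q_def)
    show "norm (x - t *\<^sub>R (A *v x)) \<le> sqrt q * norm x" for x
      using bound[of x] by (metis norm_ge_zero real_le_rsqrt real_sqrt_abs real_sqrt_mult abs_norm_cancel)
  qed
qed

text \<open>The root of \<open>I - B\<close> is \<open>I - X\<close> for the fixed point \<open>X\<close> of \<open>X \<mapsto> (B + X\<^sup>2) / 2\<close>.\<close>

lemma ex_sqrt_fixpoint:
  fixes B :: "'a::{real_inner,banach} \<Rightarrow>\<^sub>L 'a"
  assumes "norm B < 1" and B_sym: "\<And>x y. blinfun_apply B x \<bullet> y = x \<bullet> blinfun_apply B y"
  obtains X where "norm X < 1" "\<And>x y. blinfun_apply X x \<bullet> y = x \<bullet> blinfun_apply X y"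
    "2 *\<^sub>R X = B + (X o\<^sub>L X)"
proof -
  define r where "r = norm B"
  define f where "f = (\<lambda>X. (1 / 2) *\<^sub>R (B + (X o\<^sub>L X)))"
  \<comment> \<open>Symmetry is a closed condition, so it is built into the complete set on which
    \<open>f\<close> contracts; the fixed point is then symmetric at once.\<close>
  define S where "S = cball (0 :: 'a \<Rightarrow>\<^sub>L 'a) r \<inter> (\<Inter>x. \<Inter>y. {X. blinfun_apply X x \<bullet> y = x \<bullet> blinfun_apply X y})"
  have r: "0 \<le> r" "r < 1"
    using assms by (auto simp: r_def)
  have "closed S"
    unfolding S_def by (intro closed_Int closed_INT closed_cball ballI closed_Collect_eq continuous_intros)
  then have "complete S"
    by (simp add: complete_eq_closed)
  moreover have "B \<in> S"
    using B_sym by (auto simp: S_def r_def)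
  moreover have "f ` S \<subseteq> S"
  proof (rule image_subsetI)
    fix X assume X: "X \<in> S"
    then have nX: "norm X \<le> r" and sX: "\<And>x y. blinfun_apply X x \<bullet> y = x \<bullet> blinfun_apply X y"
      by (auto simp: S_def)
    have "norm (X o\<^sub>L X) \<le> r * r"
      using norm_blinfun_compose[of X X] mult_mono[OF nX nX] r by auto
    also have "\<dots> \<le> r"
      using r by (simp add: mult_left_le)
    finally have "norm (B + (X o\<^sub>L X)) \<le> r + r"
      using norm_triangle_ineq[of B "X o\<^sub>L X"] by (simp add: r_def)
    then show "f X \<in> S"
      by (simp add: S_def f_def blinfun.bilinear_simps inner_add_left inner_add_right B_sym sX)
  qed
  moreover have "dist (f X) (f Y) \<le> r * dist X Y" if "X \<in> S" "Y \<in> S" for X Y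
  proof -
    have n: "norm X \<le> r" "norm Y \<le> r"
      using that by (auto simp: S_def)
    \<comment> \<open>Noncommutative factorisation of \<open>X^2 - Y^2\<close>: each product has one
      factor of norm at most \<open>r\<close>, and the halving leaves the Lipschitz constant
      \<open>r\<close>.\<close>
    have "f X - f Y = (1 / 2) *\<^sub>R ((X o\<^sub>L (X - Y)) + ((X - Y) o\<^sub>L Y))"
      by (rule blinfun_eqI) (simp add: f_def blinfun.bilinear_simps scaleR_diff_right scaleR_add_right)
    then have "norm (f X - f Y) \<le> (norm (X o\<^sub>L (X - Y)) + norm ((X - Y) o\<^sub>L Y)) / 2"
      using norm_triangle_ineq[of "X o\<^sub>L (X - Y)" "(X - Y) o\<^sub>L Y"] by simp
    also have "\<dots> \<le> (r * norm (X - Y) + norm (X - Y) * r) / 2"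
      using norm_blinfun_compose[of X "X - Y"] norm_blinfun_compose[of "X - Y" Y]
        mult_right_mono[OF n(1), of "norm (X - Y)"] mult_left_mono[OF n(2), of "norm (X - Y)"]
      by (simp add: mult.commute)
    finally show ?thesis
      by (simp add: dist_norm)
  qed
  ultimately obtain X where X: "X \<in> S" "f X = X"
    using Banach_fix[of S r f] r by blast
  show ?thesis
  proof
    show "norm X < 1" "\<And>x y. blinfun_apply X x \<bullet> y = x \<bullet> blinfun_apply X y"
      using X(1) r by (auto simp: S_def)
    show "2 *\<^sub>R X = B + (X o\<^sub>L X)"
      using arg_cong[OF X(2), of "(*\<^sub>R) 2"] by (simp add: f_def)
  qed
qed

text \<open>For \<open>B = I - t A\<close> the fixed point satisfies
  \<open>(I - X)^2 = I - 2 X + X^2 = I - B = t A\<close>, so \<open>I - X\<close> divided by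
  \<open>sqrt t\<close> squares to \<open>A\<close>. It inherits symmetry from \<open>X\<close>, and
  \<open>norm X < 1\<close> makes it positive definite by Cauchy-Schwarz.\<close>

lemma ex_pd_sqrt:
  fixes A :: "real ^ 'n ^ 'n::finite"
  assumes A: "sym_posdef A"
  shows "\<exists>S. sym_posdef S \<and> S ** S = A"
proof -
  obtain t r where t: "t > 0" and r: "0 \<le> r" "r < 1"
    and tr: "\<And>x. norm (x - t *\<^sub>R (A *v x)) \<le> r * norm x"
    using ex_contracting_scale[OF A] by blast
  have A_sym: "(A *v x) \<bullet> y = x \<bullet> (A *v y)" for x y
    using A sym_inner by (auto simp: sym_posdef_def)
  define B where "B = Blinfun (\<lambda>x. x - t *\<^sub>R (A *v x))"
  have B: "blinfun_apply B x = x - t *\<^sub>R (A *v x)" for x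
    unfolding B_def
    by (subst bounded_linear_Blinfun_apply) (auto intro!: bounded_linear_intros)
  have "norm B < 1"
    using norm_blinfun_bound[of r B] r tr by (simp add: B)
  moreover have "blinfun_apply B x \<bullet> y = x \<bullet> blinfun_apply B y" for x y
    by (simp add: B inner_diff_left inner_diff_right A_sym)
  ultimately obtain X where X: "norm X < 1"
    and X_sym: "\<And>x y. blinfun_apply X x \<bullet> y = x \<bullet> blinfun_apply X y"
    and X_fix: "2 *\<^sub>R X = B + (X o\<^sub>L X)"
    using ex_sqrt_fixpoint by blast
  define c where "c = 1 / sqrt t"
  have c: "c > 0" "c * c * t = 1"
    using t by (auto simp: c_def)
  define S where "S = matrix (\<lambda>x. c *\<^sub>R (x - blinfun_apply X x))"
  have "linear (\<lambda>x. c *\<^sub>R (x - blinfun_apply X x))"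
    by (rule linearI) (simp_all add: blinfun.bilinear_simps algebra_simps)
  then have S: "S *v x = c *\<^sub>R (x - blinfun_apply X x)" for x
    unfolding S_def by (simp add: matrix_works linear_matrix_vector_mul_eq)
  have "(S ** S) *v x = A *v x" for x
  proof -
    have "2 *\<^sub>R blinfun_apply X x = (x - t *\<^sub>R (A *v x)) + blinfun_apply X (blinfun_apply X x)"
      using arg_cong[OF X_fix, of "\<lambda>F. blinfun_apply F x"] by (simp add: blinfun.bilinear_simps B)
    then have "x - 2 *\<^sub>R blinfun_apply X x + blinfun_apply X (blinfun_apply X x) = t *\<^sub>R (A *v x)"
      by (simp add: algebra_simps)
    moreover have "(S ** S) *v x
        = (c * c) *\<^sub>R (x - 2 *\<^sub>R blinfun_apply X x + blinfun_apply X (blinfun_apply X x))"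
      by (simp add: matrix_vector_mul_assoc[symmetric] S blinfun.bilinear_simps algebra_simps scaleR_2)
    ultimately show ?thesis
      using c by simp
  qed
  then have "S ** S = A"
    by (simp add: matrix_eq)
  moreover have "0 < x \<bullet> (S *v x)" if "x \<noteq> 0" for x
  proof -
    have "x \<bullet> blinfun_apply X x \<le> norm x * (norm X * norm x)"
      by (meson Cauchy_Schwarz_ineq2 abs_le_D1 mult_left_mono norm_blinfun norm_ge_zero order_trans)
    also have "\<dots> < x \<bullet> x"
      using X that by (simp add: dot_square_norm power2_eq_square)
    finally show ?thesis
      using c by (simp add: S inner_diff_right)
  qed
  moreover have "transpose S = S"
  proof -
    have "x \<bullet> (transpose S *v y) = x \<bullet> (S *v y)" for x y
    proof -
      have "x \<bullet> (transpose S *v y) = (S *v x) \<bullet> y"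
        by (metis dot_lmul_matrix transpose_transpose vector_transpose_matrix)
      also have "\<dots> = x \<bullet> (S *v y)"
        by (simp add: S inner_diff_left inner_diff_right X_sym)
      finally show ?thesis .
    qed
    then have "transpose S *v y = S *v y" for y
      using vector_eq_ldot by blast
    then show ?thesis
      by (simp only: matrix_eq simp_thms)
  qed
  ultimately show ?thesis
    by (auto simp: sym_posdef_def)
qed

text \<open>With \<open>D = S - T\<close> and \<open>P = S + T\<close> we have \<open>P D + D P = 2 (S\<^sup>2 - T\<^sup>2) = 0\<close>, so the trace of
  \<open>D P D\<close>, a sum of values of the quadratic form of \<open>P\<close> at the columns of \<open>D\<close>, vanishes.\<close>

lemma pd_sqrt_unique:
  fixes S T :: "real ^ 'n ^ 'n::finite"
  assumes S: "sym_posdef S" and T: "sym_posdef T" and eq: "S ** S = T ** T"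
  shows "S = T"
proof -
  define D where "D = S - T"
  define P where "P = S + T"
  have D_sym: "transpose D = D"
    using S T by (simp add: D_def sym_posdef_def transpose_def vec_eq_iff)
  have P_nonneg: "0 \<le> x \<bullet> (P *v x)" and P_pos: "x \<noteq> 0 \<Longrightarrow> 0 < x \<bullet> (P *v x)" for x
    using S T by (cases "x = 0"; force simp: P_def sym_posdef_def matrix_vector_mult_add_rdistrib
      inner_add_right add_pos_pos)+
  have "(P ** D + D ** P) *v x = 0" for x
  proof -
    have "(S ** S) *v x = (T ** T) *v x"
      by (simp add: eq)
    then have "S *v (S *v x) = T *v (T *v x)"
      by (simp add: matrix_vector_mul_assoc)
    then show ?thesis
      by (simp add: matrix_vector_mul_assoc[symmetric] matrix_vector_mult_add_rdistrib P_def D_def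
          matrix_vector_mult_diff_rdistrib matrix_vector_right_distrib
          matrix_vector_mult_diff_distrib)
  qed
  then have "P ** D + D ** P = 0"
    by (simp add: matrix_eq)
  then have "D ** P = - (P ** D)"
    by (simp add: eq_neg_iff_add_eq_0 add.commute)
  \<comment> \<open>Anticommutation moves \<open>P\<close> past \<open>D\<close> at the cost of a
    sign, and cyclicity of the trace moves it back, so the trace equals its own negative.\<close>
  then have "trace (D ** (P ** D)) = trace (- (P ** D) ** D)"
    by (simp only: matrix_mul_assoc)
  also have "\<dots> = - trace ((P ** D) ** D)"
    by (simp add: trace_def matrix_matrix_mult_def[of _ D] sum_negf)
  also have "trace ((P ** D) ** D) = trace (D ** (P ** D))"
    by (rule trace_mul_sym)
  finally have tr: "trace (D ** (P ** D)) = 0"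
    by simp
  have "trace (D ** (P ** D)) = (\<Sum>i\<in>UNIV. (D *v axis i 1) \<bullet> (P *v (D *v axis i 1)))"
  proof -
    have "(D ** (P ** D)) $ i $ i = (D *v axis i 1) \<bullet> (P *v (D *v axis i 1))" for i
    proof -
      have "(D ** (P ** D)) $ i $ i = ((D ** (P ** D)) *v axis i 1) $ i"
        by (simp add: matrix_vector_mult_basis column_def)
      also have "\<dots> = axis i 1 \<bullet> (D *v (P *v (D *v axis i 1)))"
        by (simp add: inner_axis' matrix_vector_mul_assoc)
      also have "\<dots> = (D *v axis i 1) \<bullet> (P *v (D *v axis i 1))"
        by (simp add: sym_inner[OF D_sym])
      finally show ?thesis .
    qed
    then show ?thesis
      by (simp add: trace_def)
  qed
  with tr have "(D *v axis i 1) \<bullet> (P *v (D *v axis i 1)) = 0" for i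
    using P_nonneg by (simp add: sum_nonneg_eq_0_iff)
  then have "D *v axis i 1 = 0" for i
    using P_pos by (metis less_irrefl)
  then have "D = 0"
    by (simp add: matrix_vector_mult_basis vec_eq_iff column_def)
  then show ?thesis
    by (simp add: D_def)
qed

lemma pd_sqrt_works:
  fixes A :: "real ^ 'n ^ 'n::finite"
  assumes "sym_posdef A"
  shows "sym_posdef (pd_sqrt A)" "pd_sqrt A ** pd_sqrt A = A"
proof -
  have "\<exists>!S. sym_posdef S \<and> S ** S = A"
    using ex_pd_sqrt[OF assms] pd_sqrt_unique by blast
  from theI'[OF this] show "sym_posdef (pd_sqrt A)" "pd_sqrt A ** pd_sqrt A = A"
    by (auto simp: pd_sqrt_def)
qed

text \<open>This trades the root for the plain inverse. With \<open>S u = v\<close> and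
  \<open>S z = u\<close>, symmetry of \<open>S\<close> gives
  \<open>u . u = u . S z = S u . z = v . z\<close>, without any appeal to symmetry of an
  inverse.\<close>

lemma norm_inv_pd_sqrt:
  fixes A :: "real ^ 'n ^ 'n::finite"
  assumes "sym_posdef A"
  shows "(norm (matrix_inv (pd_sqrt A) *v v))\<^sup>2 = v \<bullet> (matrix_inv A *v v)"
proof -
  define S where "S = pd_sqrt A"
  have S: "sym_posdef S" "S ** S = A"
    using pd_sqrt_works[OF assms] by (auto simp: S_def)
  define u where "u = matrix_inv S *v v"
  define z where "z = matrix_inv A *v v"
  have Su: "S *v u = v"
    unfolding u_def by (intro invertible_mult_inv sym_posdef_invertible S)
  have "A *v z = v"
    unfolding z_def by (intro invertible_mult_inv sym_posdef_invertible assms)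
  then have "S *v (S *v z) = S *v u"
    by (simp add: matrix_vector_mul_assoc S Su)
  then have "S *v z = u"
    by (metis S(1) invertible_matrix_inv(2) matrix_vector_mul_assoc matrix_vector_mul_lid
        sym_posdef_invertible)
  moreover have "u \<bullet> (S *v z) = v \<bullet> z"
    using S sym_inner[of S u z] by (simp add: Su sym_posdef_def)
  ultimately have "(norm u)\<^sup>2 = v \<bullet> z"
    by (simp add: power2_norm_eq_inner)
  then show ?thesis
    by (simp add: u_def z_def S_def)
qed

section \<open>Reduction to the first component\<close>

lemma M_mat_mult:
  assumes "lam \<noteq> 0"
  shows "M_mat \<Phi> lam *v x = (1 / lam) *\<^sub>R hilbert_meas \<Phi> (hilbert_meas_adj \<Phi> x) + x"
proof -
  let ?f = "\<lambda>h. hilbert_meas \<Phi> (hilbert_meas_adj \<Phi> h)"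
  have "linear ?f"
    by (rule linearI)
      (simp_all add: hilbert_meas_def hilbert_meas_adj_def vec_eq_iff inner_add_right
        scaleR_left_distrib sum.distrib inner_sum_right sum_distrib_left mult.assoc)
  then show ?thesis
    using assms by (simp add: M_mat_def scaleR_matrix_vector_assoc[symmetric]
      matrix_vector_mult_add_rdistrib matrix_works linear_matrix_vector_mul_eq scaleR_add_right)
qed

text \<open>The point \<open>s0 v\<close> solves the normal equation: with \<open>z\<close> the
  image of \<open>v\<close> under the inverse of \<open>M\<close>, the residual at
  \<open>s0 v\<close> is \<open>z\<close>, while \<open>lam\<close> times \<open>s0 v\<close> is the
  adjoint applied to \<open>z\<close>. Hence no term linear in \<open>s - s0 v\<close> survives, and
  the value at \<open>s0 v\<close> is half of \<open>z . v\<close>, the reduced data term.\<close>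

lemma complete_square:
  fixes \<Phi> :: "'h::{real_inner,complete_space} ^ 'n::finite"
  assumes lam: "lam > 0"
  defines "M \<equiv> M_mat \<Phi> lam"
  defines "s0 \<equiv> \<lambda>v. (1 / lam) *\<^sub>R hilbert_meas_adj \<Phi> (matrix_inv M *v v)"
  shows "1 / 2 * (norm (v - hilbert_meas \<Phi> s))\<^sup>2 + lam / 2 * (norm s)\<^sup>2
    = 1 / 2 * (norm (matrix_inv (pd_sqrt M) *v v))\<^sup>2
      + (1 / 2 * (norm (hilbert_meas \<Phi> (s - s0 v)))\<^sup>2 + lam / 2 * (norm (s - s0 v))\<^sup>2)"
proof -
  have M: "sym_posdef M"
    using lam by (simp add: M_def sym_posdef_M_mat)
  define z where "z = matrix_inv M *v v"
  define d where "d = s - s0 v"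
  define h where "h = hilbert_meas \<Phi> d"
  have s: "s = s0 v + d"
    by (simp add: d_def)
  have scale: "lam *\<^sub>R s0 v = hilbert_meas_adj \<Phi> z"
    using lam by (simp add: s0_def z_def)
  have "M *v z = v"
    unfolding z_def by (intro invertible_mult_inv sym_posdef_invertible M)
  moreover have "hilbert_meas \<Phi> (s0 v) = (1 / lam) *\<^sub>R hilbert_meas \<Phi> (hilbert_meas_adj \<Phi> z)"
    by (simp add: s0_def z_def hilbert_meas_def vec_eq_iff)
  ultimately have s0: "hilbert_meas \<Phi> (s0 v) = v - z"
    using lam by (simp add: M_def M_mat_mult algebra_simps)
  have "hilbert_meas \<Phi> s = hilbert_meas \<Phi> (s0 v) + h"
    by (simp add: s h_def hilbert_meas_def vec_eq_iff inner_add_right)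
  then have e: "v - hilbert_meas \<Phi> s = z - h"
    by (simp add: s0)
  \<comment> \<open>The cross term of the penalty, which cancels the one of the squared
    residual.\<close>
  have sd: "lam * (s0 v \<bullet> d) = z \<bullet> h"
    by (metis h_def hilbert_meas_adjoint inner_commute inner_scaleR_left scale)
  have "lam * (s0 v \<bullet> s0 v) = z \<bullet> (v - z)"
    by (metis s0 hilbert_meas_adjoint inner_commute inner_scaleR_left scale)
  then have s0s0: "lam * (s0 v \<bullet> s0 v) = z \<bullet> v - z \<bullet> z"
    by (simp add: inner_diff_right)
  have "(norm (v - hilbert_meas \<Phi> s))\<^sup>2 = z \<bullet> z - 2 * (z \<bullet> h) + h \<bullet> h"
    by (simp add: e power2_norm_eq_inner inner_diff_left inner_diff_right inner_commute)
  moreover have "lam * (norm s)\<^sup>2 = lam * (s0 v \<bullet> s0 v) + 2 * (lam * (s0 v \<bullet> d)) + lam * (d \<bullet> d)"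
    by (simp add: s power2_norm_eq_inner inner_add_left inner_add_right inner_commute algebra_simps)
  moreover have "(norm (matrix_inv (pd_sqrt M) *v v))\<^sup>2 = z \<bullet> v"
    by (simp add: norm_inv_pd_sqrt[OF M] z_def inner_commute)
  ultimately show ?thesis
    by (simp add: sd s0s0 power2_norm_eq_inner field_simps flip: d_def h_def)
qed

section \<open>Minimisers of the reduced and the joint objective\<close>

lemma argmin_set_iff: "x \<in> argmin_set f \<longleftrightarrow> (\<forall>y. f x \<le> f y)"
  by (auto simp: argmin_set_def is_arg_min_def not_less)

text \<open>At the midpoint of two minimisers the parallelogram law puts the data term
  \<open>(norm (a - b))^2 / 8\<close> below the average, while convexity keeps \<open>R\<close> at
  most at its average. Minimality forces \<open>a = b\<close>, and \<open>pd_sqrt M\<close> undoes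
  \<open>N\<close>.\<close>

lemma V_set_meas_unique:
  fixes R :: "('a::banach \<Rightarrow>\<^sub>L real) \<Rightarrow> real"
  assumes R: "convex_on UNIV R" and lam: "0 < lam" and M: "sym_posdef M"
    and s: "s \<in> V_set y \<Phi> R M lam" and t: "t \<in> V_set y \<Phi> R M lam"
  shows "dual_meas \<Phi> s = dual_meas \<Phi> t"
proof -
  define N where "N = matrix_inv (pd_sqrt M)"
  define F where "F s = 1 / 2 * (norm (N *v (y - dual_meas \<Phi> s)))\<^sup>2 + lam * R s" for s
  define u where "u = (1 / 2) *\<^sub>R s + (1 / 2) *\<^sub>R t"
  define a where "a = N *v (y - dual_meas \<Phi> s)"
  define b where "b = N *v (y - dual_meas \<Phi> t)"
  have min: "F s \<le> F u" "F t \<le> F u"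
    using s t by (auto simp: V_set_def argmin_set_iff F_def N_def)
  have "y - dual_meas \<Phi> u = (1 / 2) *\<^sub>R (y - dual_meas \<Phi> s) + (1 / 2) *\<^sub>R (y - dual_meas \<Phi> t)"
    by (simp add: dual_meas_def u_def vec_eq_iff blinfun.bilinear_simps field_simps)
  then have mid: "N *v (y - dual_meas \<Phi> u) = (1 / 2) *\<^sub>R (a + b)"
    by (simp add: a_def b_def matrix_vector_right_distrib matrix_vector_mult_scaleR scaleR_add_right)
  have "(norm ((1 / 2) *\<^sub>R (a + b)))\<^sup>2 = (norm a)\<^sup>2 / 2 + (norm b)\<^sup>2 / 2 - (norm (a - b))\<^sup>2 / 4"
    unfolding power2_norm_eq_inner
    by (simp add: inner_add_left inner_add_right inner_diff_left inner_diff_right inner_commute field_simps)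
  moreover have "R u \<le> R s / 2 + R t / 2"
    using convex_onD[OF R, of "1 / 2" s t] by (simp add: u_def)
  then have "lam * R u \<le> lam * R s / 2 + lam * R t / 2"
    using mult_left_mono[of "R u" "R s / 2 + R t / 2" lam] lam by (simp add: distrib_left)
  moreover have "F u = 1 / 2 * (norm ((1 / 2) *\<^sub>R (a + b)))\<^sup>2 + lam * R u"
    by (simp only: F_def mid)
  moreover have "F s = 1 / 2 * (norm a)\<^sup>2 + lam * R s" "F t = 1 / 2 * (norm b)\<^sup>2 + lam * R t"
    by (simp_all only: F_def a_def b_def)
  ultimately have "F u \<le> F s / 2 + F t / 2 - (norm (a - b))\<^sup>2 / 8"
    by linarith
  with min have "(norm (a - b))\<^sup>2 \<le> 0"
    by linarith
  then have "pd_sqrt M *v a = pd_sqrt M *v b"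
    by simp
  then have "y - dual_meas \<Phi> s = y - dual_meas \<Phi> t"
    using pd_sqrt_works(1)[OF M]
    by (simp add: a_def b_def N_def invertible_mult_inv sym_posdef_invertible)
  then show ?thesis
    by simp
qed

text \<open>Comparing with the pairs \<open>(s', g s')\<close>, where \<open>Q\<close> vanishes,
  eliminates the second variable. No minimiser is assumed to exist, so the empty case is
  covered.\<close>

lemma argmin_set_reduce:
  fixes F :: "'b \<Rightarrow> real" and Q :: "'b \<Rightarrow> 'c \<Rightarrow> real"
  assumes nonneg: "\<And>s t. 0 \<le> Q s t" and zero: "\<And>s t. Q s t = 0 \<longleftrightarrow> t = g s"
  shows "argmin_set (\<lambda>(s, t). F s + Q s t) = {(s, g s) | s. s \<in> argmin_set F}"
proof (rule set_eqI, clarify)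
  fix s t
  have "(s, t) \<in> argmin_set (\<lambda>(s, t). F s + Q s t) \<longleftrightarrow> (\<forall>s' t'. F s + Q s t \<le> F s' + Q s' t')"
    by (simp add: argmin_set_iff)
  also have "\<dots> \<longleftrightarrow> t = g s \<and> (\<forall>s'. F s \<le> F s')"
  proof
    assume *: "\<forall>s' t'. F s + Q s t \<le> F s' + Q s' t'"
    have "Q s' (g s') = 0" for s'
      using zero by blast
    then have **: "F s + Q s t \<le> F s'" for s'
      using * by (metis add_0_right)
    \<comment> \<open>Comparison with the same first component already forces the second to be
      optimal.\<close>
    from **[of s] have "Q s t = 0"
      using nonneg[of s t] by linarith
    then show "t = g s \<and> (\<forall>s'. F s \<le> F s')"
      using ** zero by (metis add_0_right)
  next
    assume *: "t = g s \<and> (\<forall>s'. F s \<le> F s')"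
    then have "Q s t = 0"
      using zero by blast
    then show "\<forall>s' t'. F s + Q s t \<le> F s' + Q s' t'"
      using * nonneg by (simp add: add_increasing2)
  qed
  finally show "(s, t) \<in> argmin_set (\<lambda>(s, t). F s + Q s t)
      \<longleftrightarrow> (s, t) \<in> {(s, g s) | s. s \<in> argmin_set F}"
    by (auto simp: argmin_set_iff)
qed

text \<open>The second component still varies with \<open>s\<close> here; the set becomes a product
  only once all reduced minimisers are known to share one measurement.\<close>

lemma W_set_eq:
  fixes \<Phi>2 :: "'h::{real_inner,complete_space} ^ 'n::finite"
  assumes "0 < lam2"
  shows "W_set y \<Phi>1 \<Phi>2 R lam1 lam2
    = {(s, (1 / lam2) *\<^sub>R hilbert_meas_adj \<Phi>2 (matrix_inv (M_mat \<Phi>2 lam2) *v (y - dual_meas \<Phi>1 s))) | s.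
        s \<in> V_set y \<Phi>1 R (M_mat \<Phi>2 lam2) lam1}"
proof -
  define g where
    "g s = (1 / lam2) *\<^sub>R hilbert_meas_adj \<Phi>2 (matrix_inv (M_mat \<Phi>2 lam2) *v (y - dual_meas \<Phi>1 s))"
    for s
  define F where
    "F s = 1 / 2 * (norm (matrix_inv (pd_sqrt (M_mat \<Phi>2 lam2)) *v (y - dual_meas \<Phi>1 s)))\<^sup>2 + lam1 * R s"
    for s
  define Q where
    "Q s t = 1 / 2 * (norm (hilbert_meas \<Phi>2 (t - g s)))\<^sup>2 + lam2 / 2 * (norm (t - g s))\<^sup>2" for s t
  have "1 / 2 * (norm (y - (dual_meas \<Phi>1 s + hilbert_meas \<Phi>2 t)))\<^sup>2 + lam1 * R s
      + lam2 / 2 * (norm t)\<^sup>2 = F s + Q s t" for s t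
    using complete_square[OF assms, of "y - dual_meas \<Phi>1 s" \<Phi>2 t]
    by (simp add: F_def Q_def g_def diff_diff_eq)
  then have "W_set y \<Phi>1 \<Phi>2 R lam1 lam2 = argmin_set (\<lambda>(s, t). F s + Q s t)"
    by (simp add: W_set_def)
  also have "\<dots> = {(s, g s) | s. s \<in> argmin_set F}"
  proof (rule argmin_set_reduce)
    show "0 \<le> Q s t" for s t
      using assms by (simp add: Q_def)
    \<comment> \<open>The penalty has the positive weight \<open>lam2 / 2\<close>, so it alone
      forces \<open>t - g s\<close> to vanish, whatever the kernel of the measurement map.\<close>
    show "Q s t = 0 \<longleftrightarrow> t = g s" for s t
      using assms by (auto simp: Q_def add_nonneg_eq_0_iff hilbert_meas_def vec_eq_iff)
  qed
  finally show ?thesis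
    by (simp add: V_set_def F_def[abs_def] g_def)
qed

theorem theorem1:
  fixes R :: "('a::banach \<Rightarrow>\<^sub>L real) \<Rightarrow> real"
    and y :: "real ^ 'n::finite"
    and lam1 lam2 :: real
    and \<Phi>1 :: "'a ^ 'n"
    and \<Phi>2 :: "'h::{real_inner,complete_space} ^ 'n"
  assumes R_nonneg: "\<And>s. 0 \<le> R s"
    and R_convex: "convex_on UNIV R"
    and "0 < lam1" and "0 < lam2"
  shows "(\<forall>s\<in>V_set y \<Phi>1 R (M_mat \<Phi>2 lam2) lam1. \<forall>t\<in>V_set y \<Phi>1 R (M_mat \<Phi>2 lam2) lam1.
            dual_meas \<Phi>1 s = dual_meas \<Phi>1 t)
    \<and> (\<forall>w\<in>dual_meas \<Phi>1 ` V_set y \<Phi>1 R (M_mat \<Phi>2 lam2) lam1.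
            W_set y \<Phi>1 \<Phi>2 R lam1 lam2 = V_set y \<Phi>1 R (M_mat \<Phi>2 lam2) lam1 \<times>
              {(1 / lam2) *\<^sub>R hilbert_meas_adj \<Phi>2 (matrix_inv (M_mat \<Phi>2 lam2) *v (y - w))})
    \<and> (V_set y \<Phi>1 R (M_mat \<Phi>2 lam2) lam1 = {} \<longrightarrow> W_set y \<Phi>1 \<Phi>2 R lam1 lam2 = {})"
proof -
  let ?V = "V_set y \<Phi>1 R (M_mat \<Phi>2 lam2) lam1"
  have unique: "dual_meas \<Phi>1 s = dual_meas \<Phi>1 t" if "s \<in> ?V" "t \<in> ?V" for s t
    using V_set_meas_unique[OF R_convex \<open>0 < lam1\<close> sym_posdef_M_mat[OF \<open>0 < lam2\<close>] that] .
  moreover have "W_set y \<Phi>1 \<Phi>2 R lam1 lam2 = ?V \<times>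
      {(1 / lam2) *\<^sub>R hilbert_meas_adj \<Phi>2 (matrix_inv (M_mat \<Phi>2 lam2) *v (y - w))}"
    if "w \<in> dual_meas \<Phi>1 ` ?V" for w
  proof -
    \<comment> \<open>Every reduced minimiser measures to the given \<open>w\<close>, so the second
      components in \<open>W_set_eq\<close> all coincide.\<close>
    have w: "dual_meas \<Phi>1 s = w" if "s \<in> ?V" for s
      using \<open>w \<in> dual_meas \<Phi>1 ` ?V\<close> unique that by blast
    show ?thesis
      unfolding W_set_eq[OF \<open>0 < lam2\<close>] by (auto simp: w)
  qed
  moreover have "W_set y \<Phi>1 \<Phi>2 R lam1 lam2 = {}" if "?V = {}"
    using that by (simp add: W_set_eq[OF \<open>0 < lam2\<close>])
  ultimately show ?thesis
    by blast
qed

end
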